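(* Let $n,d\ge 1$ be integers. If a line arrangement $\mathcal{L}$ in $\mathbb{C}^n$ (a set of one-dimensional linear subspaces) has matroid $\mathcal{T}_{n,d}$ (i.e. its matroid of linear dependence is isomorphic to $\mathcal{T}_{n,d}$), then it can be realized as the arrangement of one-dimensional intersections of $d$ complete flags: there exist complete flags $E^1_\bullet,\dots,E^d_\bullet$ in $\mathbb{C}^n$ such that $\mathcal{L}$ is exactly the set of one-dimensional subspaces of the form $E^1_{a_1}\cap E^2_{a_2}\cap\cdots\cap E^d_{a_d}$.
   Context: A complete flag $E_\bullet$ in $\mathbb{C}^n$ is a chain $\{0\}=E_0\subset E_1\subset\cdots\subset E_n=\mathbb{C}^n$ with $\dim E_i=i$. Let $T_{n,d}=\{x\in\mathbb{Z}_{\ge 0}^d : x_1+\cdots+x_d=n-1\}$. For $1\le k\le n$ and nonnegative integers $a_1,\dots,a_d$ with $\sum a_i=n-k$, the set $\{x\in T_{n,d}: x_i\ge a_i\ \forall i\}$ is called a simplex of size $k$ in $T_{n,d}$. $\mathcal{T}_{n,d}$ is the matroid on ground set $T_{n,d}$ whose independent sets are the subsets $I\subseteq T_{n,d}$ such that every simplex of size $k$ contains at most $k$ points of $I$, for every $k\le n$. The matroid of a line arrangement has the lines as ground set; a set of lines is independent if choosing a nonzero vector in each gives linearly independent vectors. *)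

theory Defs
  imports "HOL-Analysis.Analysis"
begin

text \<open>
  Dimensions are types: \<open>\<complex>\<^sup>n\<close> is \<open>complex ^ 'n\<close> with \<open>n = CARD('n)\<close>, and \<open>\<int>\<^sub>\<ge>\<^sub>0\<^sup>d\<close> is \<open>nat ^ 'd\<close>
  with \<open>d = CARD('d)\<close>. Subspaces, dimension and linear independence are taken over the
  field \<open>complex\<close> (the constants \<open>vec.subspace\<close>, \<open>vec.dim\<close>, \<open>vec.dependent\<close>); the unqualified
  constants of the library refer to the real vector space structure.
\<close>

text \<open>A matroid is represented by its ground set and its family of independent sets.\<close>

type_synonym 'a matroid = "'a set \<times> 'a set set"

definition matroid_iso :: "'a matroid \<Rightarrow> 'b matroid \<Rightarrow> bool" where
  "matroid_iso M N \<longleftrightarrow>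
     (\<exists>\<phi>. bij_betw \<phi> (fst M) (fst N) \<and>
          (\<forall>I. I \<subseteq> fst M \<longrightarrow> (I \<in> snd M \<longleftrightarrow> \<phi> ` I \<in> snd N)))"

definition T_points :: "nat \<Rightarrow> (nat ^ 'd::finite) set" where
  "T_points n = {x. (\<Sum>i\<in>UNIV. x $ i) = n - 1}"

definition is_simplex :: "nat \<Rightarrow> nat \<Rightarrow> (nat ^ 'd::finite) set \<Rightarrow> bool" where
  "is_simplex n k S \<longleftrightarrow>
     1 \<le> k \<and> k \<le> n \<and>
     (\<exists>a :: nat ^ 'd. (\<Sum>i\<in>UNIV. a $ i) = n - k \<and> S = {x \<in> T_points n. \<forall>i. a $ i \<le> x $ i})"

definition T_matroid :: "nat \<Rightarrow> (nat ^ 'd::finite) matroid" where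
  "T_matroid n =
     (T_points n,
      {I. I \<subseteq> T_points n \<and> (\<forall>k S. is_simplex n k S \<longrightarrow> card (I \<inter> S) \<le> k)})"

definition line_arrangement :: "(complex ^ 'n) set set \<Rightarrow> bool" where
  "line_arrangement L \<longleftrightarrow> (\<forall>l\<in>L. vec.subspace l \<and> vec.dim l = 1)"

text \<open>
  Nonzero vectors chosen in distinct lines are distinct, so independence of the image set
  \<open>v ` I\<close> is independence of the family of chosen vectors.
\<close>

definition line_matroid :: "(complex ^ 'n) set set \<Rightarrow> (complex ^ 'n) set matroid" where
  "line_matroid L =
     (L, {I. I \<subseteq> L \<and>
             (\<forall>v. (\<forall>l\<in>I. v l \<in> l \<and> v l \<noteq> 0) \<longrightarrow> \<not> vec.dependent (v ` I))})"

definition complete_flag :: "(nat \<Rightarrow> (complex ^ 'n) set) \<Rightarrow> bool" where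
  "complete_flag E \<longleftrightarrow>
     E 0 = {0} \<and> E CARD('n) = UNIV \<and>
     (\<forall>i\<le>CARD('n). vec.subspace (E i) \<and> vec.dim (E i) = i) \<and>
     (\<forall>i<CARD('n). E i \<subset> E (Suc i))"

definition flag_lines :: "('d::finite \<Rightarrow> nat \<Rightarrow> (complex ^ 'n) set) \<Rightarrow> (complex ^ 'n) set set" where
  "flag_lines E =
     {l. vec.dim l = 1 \<and> (\<exists>a :: 'd \<Rightarrow> nat. (\<forall>i. a i \<le> CARD('n)) \<and> l = (\<Inter>i. E i (a i)))}"

end

theory Submission
  imports Defs
begin

text \<open>
  Let \<open>v x\<close> span the line with label \<open>x\<close>, and let \<open>U(a)\<close> be the span of all \<open>v x\<close> with
  \<open>x \<ge> a\<close>. The defining inequalities of the matroid give \<open>dim U(a) \<le> n - \<bar>a\<bar>\<close>. Conversely, any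
  set of labels with pairwise distinct \<open>j\<close>-th coordinates is independent, because those coordinates
  range over only \<open>k\<close> values on a simplex of size \<open>k\<close>. If \<open>d \<ge> 2\<close>, this provides enough independent
  sets to see that \<open>dim U(a) = n - \<bar>a\<bar>\<close> and that \<open>U(a) + U(m e\<^sub>j)\<close> is the whole space when
  \<open>a\<^sub>j = 0\<close> and \<open>\<bar>a\<bar> + m \<le> n\<close>; hence \<open>U(a) \<inter> U(m e\<^sub>j) = U(a + m e\<^sub>j)\<close> by dimension.
  So the flags \<open>k \<mapsto> U((n - k) e\<^sub>i)\<close> have exactly the spaces \<open>U(a)\<close> as intersections, and these
  are one-dimensional only when \<open>\<bar>a\<bar> = n - 1\<close>, that is, when \<open>U(a)\<close> is the line labelled \<open>a\<close>.
  For \<open>d = 1\<close> the spaces \<open>U(a)\<close> do not form a flag, but the arrangement is a single line and any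
  flag through it will do.
\<close>

section \<open>Labels: weights and coordinates\<close>

abbreviation weight :: "nat ^ 'd::finite \<Rightarrow> nat" where
  "weight x \<equiv> \<Sum>i\<in>UNIV. x $ i"

lemma weight_axis: "weight (axis j m) = m"
  by (simp add: axis_def)

lemma weight_add: "weight (x + y) = weight x + weight y"
  by (simp add: sum.distrib)

lemma weight_mono: "x \<le> y \<Longrightarrow> weight x \<le> weight y"
  by (simp add: less_eq_vec_def sum_mono)

lemma weight_eq_imp_eq:
  assumes "x \<le> y" "weight x = weight y"
  shows "x = y"
proof (rule ccontr)
  assume "x \<noteq> y"
  then obtain i where "x $ i < y $ i"
    using assms(1) by (metis less_eq_vec_def order_le_less vec_eq_iff)
  then have "weight x < weight y"
    using assms(1) by (intro sum_strict_mono_ex1) (auto simp: less_eq_vec_def)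
  then show False
    using assms(2) by simp
qed

lemma distinct_coordinate_independent:
  assumes "J \<subseteq> T_points n" and inj: "inj_on (\<lambda>x. x $ j) J"
  shows "J \<in> snd (T_matroid n)"
proof -
  have "card (J \<inter> S) \<le> k" if S: "is_simplex n k S" for k S
  proof -
    obtain a where k: "1 \<le> k" "k \<le> n" and a: "weight a = n - k"
      and Seq: "S = {x \<in> T_points n. \<forall>i. a $ i \<le> x $ i}"
      using S unfolding is_simplex_def by blast
    \<comment> \<open>The total slack \<open>weight x - weight a\<close> is
      \<open>(n - 1) - (n - k) = k - 1\<close>, and no single coordinate can use more than
      that.\<close>
    have "x $ j \<in> {a $ j..<a $ j + k}" if "x \<in> S" for x
    proof -
      have x: "weight x = n - 1" "\<And>i. a $ i \<le> x $ i"
        using that by (auto simp: Seq T_points_def)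
      have "(\<Sum>i\<in>UNIV - {j}. a $ i) \<le> (\<Sum>i\<in>UNIV - {j}. x $ i)"
        by (intro sum_mono x)
      moreover have "weight a = a $ j + (\<Sum>i\<in>UNIV - {j}. a $ i)"
        "weight x = x $ j + (\<Sum>i\<in>UNIV - {j}. x $ i)"
        by (simp_all add: sum.remove)
      ultimately show ?thesis
        using x a k by auto
    qed
    then have "(\<lambda>x. x $ j) ` (J \<inter> S) \<subseteq> {a $ j..<a $ j + k}"
      by blast
    then have "card ((\<lambda>x. x $ j) ` (J \<inter> S)) \<le> card {a $ j..<a $ j + k}"
      by (intro card_mono) auto
    then show ?thesis
      by (simp add: card_image inj_on_subset[OF inj])
  qed
  then show ?thesis
    using assms by (simp add: T_matroid_def)
qed

lemma exists_point_with_coordinate: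
  fixes a :: "nat ^ 'd::finite"
  assumes "i \<noteq> j" "a $ j \<le> t" "t + weight a < n + a $ j"
  obtains x where "x \<in> T_points n" "a \<le> x" "x $ j = t"
proof
  \<comment> \<open>Raise coordinate \<open>j\<close> to \<open>t\<close> and store the leftover
    weight in \<open>i\<close>, which leaves coordinate \<open>j\<close> alone. The bound on
    \<open>t\<close> makes the truncated subtractions exact.\<close>
  let ?x = "a + axis j (t - a $ j) + axis i (n - 1 - (t - a $ j) - weight a)"
  show "?x \<in> T_points n"
    using assms by (simp add: T_points_def weight_add weight_axis del: vector_add_component)
  show "a \<le> ?x"
    by (simp add: less_eq_vec_def)
  show "?x $ j = t"
    using assms by (simp add: axis_def)
qed

locale T_representation =
  fixes v :: "nat ^ 'd::finite \<Rightarrow> complex ^ 'n"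
  assumes independent_iff: "J \<subseteq> T_points CARD('n) \<Longrightarrow>
      inj_on v J \<and> \<not> vec.dependent (v ` J) \<longleftrightarrow> J \<in> snd (T_matroid CARD('n))"
    and nontrivial: "\<exists>i. i \<noteq> (j :: 'd)"
begin

section \<open>Dimensions of the spans U(a)\<close>

definition simplex_span :: "nat ^ 'd \<Rightarrow> (complex ^ 'n) set" where
  "simplex_span a = vec.span (v ` {x \<in> T_points CARD('n). a \<le> x})"

lemma subspace_simplex_span: "vec.subspace (simplex_span a)"
  by (simp add: simplex_span_def)

lemma simplex_span_antimono: "a \<le> b \<Longrightarrow> simplex_span b \<subseteq> simplex_span a"
  unfolding simplex_span_def by (intro vec.span_mono image_mono) auto

text \<open>Source of all lower bounds on dimension: picking one label of \<open>P\<close> for each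
  value in \<open>K\<close> gives distinct \<open>j\<close>-th coordinates, hence independent
  vectors.\<close>

lemma card_coordinates_le_dim:
  assumes "P \<subseteq> T_points CARD('n)" "K \<subseteq> (\<lambda>x. x $ j) ` P"
  shows "card K \<le> vec.dim (v ` P)"
proof -
  obtain J where J: "J \<subseteq> P" "inj_on (\<lambda>x. x $ j) J" "K = (\<lambda>x. x $ j) ` J"
    using assms(2) by (auto simp: subset_image_inj)
  then have "inj_on v J" and ind: "\<not> vec.dependent (v ` J)"
    using distinct_coordinate_independent[of J _ j] independent_iff[of J] assms(1) by auto
  then have "card K = card (v ` J)"
    using J by (simp add: card_image)
  also have "\<dots> \<le> vec.dim (v ` P)"
    using J ind by (intro vec.independent_card_le_dim) auto
  finally show ?thesis .
qed

lemma dim_simplex_span_le: "vec.dim (simplex_span a) \<le> CARD('n) - weight a"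
proof (cases "weight a < CARD('n)")
  \<comment> \<open>A simplex has size at least 1, so this range is separate: labels have weight n -
    1, so none lies above \<open>a\<close>.\<close>
  case False
  have "weight a \<le> CARD('n) - 1" if "x \<in> T_points CARD('n)" "a \<le> x" for x
    using weight_mono[OF that(2)] that(1) by (simp add: T_points_def)
  moreover have "CARD('n) - 1 < CARD('n)"
    by simp
  ultimately have empty: "{x \<in> T_points CARD('n). a \<le> x} = {}"
    using False by (metis (mono_tags, lifting) Collect_empty_eq le_less_trans)
  have "vec.dim (simplex_span a) = 0"
    unfolding simplex_span_def empty vec.dim_eq_0 by simp
  then show ?thesis
    by (simp only: le0)
next
  case True
  let ?S = "{x \<in> T_points CARD('n). a \<le> x}"
  \<comment> \<open>A basis drawn from the generators is the image of an independent set of labels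
    inside a simplex of size n - |a|, so the matroid bounds its cardinality.\<close>
  obtain B where B: "B \<subseteq> v ` ?S" "\<not> vec.dependent B" "v ` ?S \<subseteq> vec.span B"
      "card B = vec.dim (v ` ?S)"
    by (rule vec.basis_exists)
  then obtain J where J: "J \<subseteq> ?S" "inj_on v J" "B = v ` J"
    by (auto simp: subset_image_inj)
  then have "J \<in> snd (T_matroid CARD('n))"
    using independent_iff[of J] B by auto
  moreover have "is_simplex CARD('n) (CARD('n) - weight a) ?S"
    using True unfolding is_simplex_def less_eq_vec_def by (intro conjI exI[of _ a]) auto
  ultimately have "card (J \<inter> ?S) \<le> CARD('n) - weight a"
    unfolding T_matroid_def by auto
  moreover have "J \<inter> ?S = J"
    using J by auto
  ultimately show ?thesis
    using B J by (simp add: simplex_span_def card_image)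
qed

lemma simplex_span_large: "CARD('n) \<le> weight a \<Longrightarrow> simplex_span a = {0}"
  using dim_simplex_span_le[of a] vec.subspace_0[OF subspace_simplex_span[of a]] by auto

text \<open>The interval has n - |a| elements for every \<open>j\<close>, exactly the upper bound
  already known for the dimension.\<close>

lemma coordinates_simplex:
  fixes a :: "nat ^ 'd"
  shows "{a $ j..<CARD('n) + a $ j - weight a} \<subseteq> (\<lambda>x. x $ j) ` {x \<in> T_points CARD('n). a \<le> x}"
proof
  fix t assume t: "t \<in> {a $ j..<CARD('n) + a $ j - weight a}"
  obtain i where "i \<noteq> j"
    using nontrivial by blast
  then obtain x where "x \<in> T_points CARD('n)" "a \<le> x" "x $ j = t"
    using t by (elim exists_point_with_coordinate[of i j a t "CARD('n)"]) auto
  then show "t \<in> (\<lambda>x. x $ j) ` {x \<in> T_points CARD('n). a \<le> x}"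
    by auto
qed

lemma dim_simplex_span: "vec.dim (simplex_span a) = CARD('n) - weight a"
proof (rule antisym[OF dim_simplex_span_le])
  obtain j :: 'd where True
    by simp
  show "CARD('n) - weight a \<le> vec.dim (simplex_span a)"
    using card_coordinates_le_dim[OF _ coordinates_simplex[of a j]]
    by (auto simp: simplex_span_def)
qed

section \<open>Intersections of the spans U(a)\<close>

lemma simplex_span_Int_axis_small:
  assumes a: "a $ j = 0" and le: "weight a + m \<le> CARD('n)"
  shows "simplex_span a \<inter> simplex_span (axis j m) = simplex_span (a + axis j m)"
proof -
  let ?n = "CARD('n)" and ?T = "T_points CARD('n) :: (nat ^ 'd) set"
  let ?A = "simplex_span a" and ?B = "simplex_span (axis j m)" and ?C = "simplex_span (a + axis j m)"
  let ?P = "{x \<in> ?T. a \<le> x} \<union> {x \<in> ?T. axis j m \<le> x}"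
  have dims: "vec.dim ?A = ?n - weight a" "vec.dim ?B = ?n - m" "vec.dim ?C = ?n - (weight a + m)"
    by (simp_all only: dim_simplex_span weight_add weight_axis)
  \<comment> \<open>These are the \<open>j\<close>-th coordinates attained above \<open>a\<close>
    and above \<open>axis j m\<close>. By \<open>le\<close> they leave no gap, so the two spans
    together fill the whole space.\<close>
  have "{..<?n} \<subseteq> {..<?n - weight a} \<union> {m..<?n}"
    using le by auto
  also have "\<dots> \<subseteq> (\<lambda>x. x $ j) ` ?P"
    using coordinates_simplex[of a j] coordinates_simplex[of "axis j m" j] a
    unfolding weight_axis by (simp add: image_Un lessThan_atLeast0 le_supI1 le_supI2)
  finally have "?n \<le> vec.dim (v ` ?P)"
    using card_coordinates_le_dim[of ?P "{..<?n}" j] by auto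
  also have "\<dots> \<le> vec.dim {x + y |x y. x \<in> ?A \<and> y \<in> ?B}"
  proof (rule vec.dim_subset)
    have "x \<in> {x + y |x y. x \<in> ?A \<and> y \<in> ?B}" if "x \<in> ?A \<or> x \<in> ?B" for x
      using that vec.subspace_0[OF subspace_simplex_span]
      by (metis (mono_tags, lifting) add.left_neutral add.right_neutral mem_Collect_eq)
    moreover have "v ` {x \<in> ?T. a \<le> x} \<subseteq> ?A" "v ` {x \<in> ?T. axis j m \<le> x} \<subseteq> ?B"
      unfolding simplex_span_def by (auto intro: vec.span_base)
    ultimately show "v ` ?P \<subseteq> {x + y |x y. x \<in> ?A \<and> y \<in> ?B}"
      by blast
  qed
  \<comment> \<open>The sum has dimension n, so the intersection has dimension at most (n - |a|) +
    (n - m) - n.\<close>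
  finally have "vec.dim (?A \<inter> ?B) \<le> vec.dim ?C"
    using vec.dim_sums_Int[OF subspace_simplex_span subspace_simplex_span, of a "axis j m"]
      dims le by linarith
  moreover have "?C \<subseteq> ?A \<inter> ?B"
    by (intro Int_greatest simplex_span_antimono) (auto simp: less_eq_vec_def)
  ultimately show ?thesis
    using vec.subspace_dim_equal[of ?C "?A \<inter> ?B"]
    by (simp add: subspace_simplex_span vec.subspace_inter)
qed

lemma simplex_span_Int_axis:
  assumes a: "a $ j = 0"
  shows "simplex_span a \<inter> simplex_span (axis j m) = simplex_span (a + axis j m)"
proof -
  have zero: "0 \<in> simplex_span b" for b
    by (intro vec.subspace_0 subspace_simplex_span)
  consider "weight a + m \<le> CARD('n)" | "CARD('n) \<le> weight a"
    | "weight a \<le> CARD('n)" "CARD('n) \<le> weight a + m"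
    by linarith
  then show ?thesis
  proof cases
    case 1
    then show ?thesis by (rule simplex_span_Int_axis_small[OF a])
  next
    case 2
    then show ?thesis
      using simplex_span_large[of a] simplex_span_large[of "a + axis j m"] zero
      by (simp add: weight_add weight_axis del: vector_add_component)
  next
    case 3
    \<comment> \<open>Lowering \<open>m\<close> to this borderline value only enlarges the
      intersection, which is already zero there.\<close>
    let ?m = "CARD('n) - weight a"
    have "simplex_span a \<inter> simplex_span (axis j m) \<subseteq> simplex_span a \<inter> simplex_span (axis j ?m)"
      using 3 by (intro Int_mono order_refl simplex_span_antimono) (auto simp: less_eq_vec_def axis_def)
    also have "\<dots> = simplex_span (a + axis j ?m)"
      using 3 by (intro simplex_span_Int_axis_small a) auto
    also have "\<dots> = {0}"
      using 3 by (intro simplex_span_large) (simp add: weight_add weight_axis del: vector_add_component)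
    finally show ?thesis
      using 3 zero simplex_span_large[of "a + axis j m"]
      by (auto simp: weight_add weight_axis simp del: vector_add_component)
  qed
qed

lemma INT_simplex_span_axis: "(\<Inter>i. simplex_span (axis i (a i))) = simplex_span (\<chi> i. a i)"
proof -
  \<comment> \<open>Adding one coordinate at a time keeps the new coordinate zero beforehand, as the
    intersection rule requires. The empty intersection matches U(0), the whole space.\<close>
  have "(\<Inter>i\<in>A. simplex_span (axis i (a i))) = simplex_span (\<chi> i. if i \<in> A then a i else 0)" for A
  proof (induction A rule: finite_induct[OF finite])
    case 1
    have "vec.dim (simplex_span 0) = CARD('n)"
      by (simp add: dim_simplex_span)
    then have "simplex_span 0 = UNIV"
      using vec.dim_eq_full[of "simplex_span 0"] subspace_simplex_span[of 0]
      by (simp add: vec.dimension_def card_cart_basis vec.span_eq_iff[THEN iffD2])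
    then show ?case
      by (simp flip: zero_vec_def)
  next
    case (2 j A)
    have "(\<chi> i. if i \<in> insert j A then a i else 0)
        = (\<chi> i. if i \<in> A then a i else 0) + axis j (a j)"
      using 2 by (auto simp: vec_eq_iff axis_def)
    then show ?case
      using 2 simplex_span_Int_axis[of "\<chi> i. if i \<in> A then a i else 0" j "a j"]
      by (simp add: Int_commute)
  qed
  from this[of UNIV] show ?thesis
    by simp
qed

text \<open>All labels have equal weight, so no other label lies above \<open>x\<close>.\<close>

lemma simplex_span_point:
  assumes "x \<in> T_points CARD('n)"
  shows "simplex_span x = vec.span {v x}"
proof -
  have "{y \<in> T_points CARD('n). x \<le> y} = {x}"
    using assms weight_eq_imp_eq by (fastforce simp: T_points_def)
  then show ?thesis
    by (simp add: simplex_span_def)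
qed

section \<open>The flags and their one-dimensional intersections\<close>

definition simplex_flag :: "'d \<Rightarrow> nat \<Rightarrow> (complex ^ 'n) set" where
  "simplex_flag i k = simplex_span (axis i (CARD('n) - k))"

lemma dim_simplex_flag: "k \<le> CARD('n) \<Longrightarrow> vec.dim (simplex_flag i k) = k"
  by (simp only: simplex_flag_def dim_simplex_span weight_axis diff_diff_cancel)

lemma complete_flag_simplex_flag: "complete_flag (simplex_flag i)"
  unfolding complete_flag_def
proof (intro conjI allI impI)
  show "simplex_flag i 0 = {0}"
    unfolding simplex_flag_def by (rule simplex_span_large) (simp only: weight_axis diff_zero)
  have "vec.span (simplex_flag i CARD('n)) = UNIV"
    using vec.dim_eq_full[of "simplex_flag i CARD('n)"] dim_simplex_flag[of "CARD('n)" i]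
    by (simp add: vec.dimension_def card_cart_basis)
  then show "simplex_flag i CARD('n) = UNIV"
    by (simp only: simplex_flag_def simplex_span_def vec.span_span)
  fix k
  show "vec.subspace (simplex_flag i k)"
    by (simp add: simplex_flag_def subspace_simplex_span)
  show "vec.dim (simplex_flag i k) = k" if "k \<le> CARD('n)"
    using that by (rule dim_simplex_flag)
  show "simplex_flag i k \<subset> simplex_flag i (Suc k)" if "k < CARD('n)"
  proof
    show "simplex_flag i k \<subseteq> simplex_flag i (Suc k)"
      unfolding simplex_flag_def by (rule simplex_span_antimono) (auto simp: less_eq_vec_def axis_def)
    show "simplex_flag i k \<noteq> simplex_flag i (Suc k)"
      using that dim_simplex_flag[of k i] dim_simplex_flag[of "Suc k" i] by auto
  qed
qed

lemma flag_lines_simplex_flag: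
  "flag_lines simplex_flag = (\<lambda>x. vec.span {v x}) ` T_points CARD('n)"
proof (intro equalityI subsetI)
  fix l assume "l \<in> flag_lines simplex_flag"
  then obtain a where "vec.dim l = 1" "l = (\<Inter>i. simplex_flag i (a i))"
    unfolding flag_lines_def by blast
  then have l: "l = simplex_span (\<chi> i. CARD('n) - a i)"
    and "CARD('n) - weight (\<chi> i. CARD('n) - a i) = 1"
    by (auto simp: simplex_flag_def INT_simplex_span_axis dim_simplex_span)
  then have "(\<chi> i. CARD('n) - a i) \<in> (T_points CARD('n) :: (nat ^ 'd) set)"
    unfolding T_points_def by simp
  then show "l \<in> (\<lambda>x. vec.span {v x}) ` T_points CARD('n)"
    using l simplex_span_point by auto
next
  fix l assume "l \<in> (\<lambda>x. vec.span {v x}) ` T_points CARD('n)"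
  then obtain x where x: "x \<in> T_points CARD('n)" and l: "l = simplex_span x"
    using simplex_span_point by auto
  then have w: "weight x = CARD('n) - 1"
    by (simp add: T_points_def)
  have "x $ i \<le> weight x" for i
    by (rule member_le_sum) auto
  \<comment> \<open>Ensures that the truncated double complement \<open>n - (n - x $ i)\<close>
    returns \<open>x $ i\<close>.\<close>
  then have xi: "x $ i \<le> CARD('n)" for i
    using w by (metis diff_le_self le_trans)
  have "l = (\<Inter>i. simplex_flag i (CARD('n) - x $ i))"
    using l xi by (simp add: simplex_flag_def INT_simplex_span_axis vec_lambda_eta)
  moreover have "vec.dim l = 1"
    using w by (simp add: l dim_simplex_span Suc_leI)
  ultimately show "l \<in> flag_lines simplex_flag"
    unfolding flag_lines_def by (auto intro!: exI[of _ "\<lambda>i. CARD('n) - x $ i"])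
qed

end

section \<open>Lines and the choice of generators\<close>

lemma line_eq_span:
  fixes l :: "(complex ^ 'n) set"
  assumes "vec.subspace l" "vec.dim l = 1" "u \<in> l" "u \<noteq> 0"
  shows "l = vec.span {u}"
proof -
  have "vec.span {u} \<subseteq> l"
    using assms by (simp add: vec.span_minimal)
  then show ?thesis
    using assms vec.subspace_dim_equal[of "vec.span {u}" l]
    by (simp add: vec.dim_eq_card_independent)
qed

lemma line_arrangement_generators:
  assumes "line_arrangement L"
  obtains w where "\<And>l. l \<in> L \<Longrightarrow> w l \<in> l \<and> w l \<noteq> 0"
proof -
  have "\<exists>u. u \<in> l \<and> u \<noteq> 0" if "l \<in> L" for l
    using that assms vec.dim_eq_0[of l] unfolding line_arrangement_def by fastforce
  then show ?thesis
    using that by metis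
qed

lemma line_matroid_independent_iff:
  assumes L: "line_arrangement L" and "I \<subseteq> L"
    and w: "\<And>l. l \<in> L \<Longrightarrow> w l \<in> l \<and> w l \<noteq> 0"
  shows "I \<in> snd (line_matroid L) \<longleftrightarrow> inj_on w I \<and> \<not> vec.dependent (w ` I)"
proof -
  have span_line: "l = vec.span {u}" if "l \<in> L" "u \<in> l" "u \<noteq> 0" for l u
    using that L line_eq_span unfolding line_arrangement_def by blast
  have inj: "inj_on w I"
  \<comment> \<open>Each line is recovered as the span of its generator.\<close>
  proof (rule inj_on_inverseI)
    show "vec.span {w l} = l" if "l \<in> I" for l
      using that \<open>I \<subseteq> L\<close> w[of l] span_line[of l "w l"] by auto
  qed
  \<comment> \<open>The vectors of \<open>u\<close> span those of \<open>w\<close>, so their span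
    has dimension at least \<open>card I\<close>; a spanning set of at most that size is
    independent.\<close>
  moreover have "\<not> vec.dependent (u ` I)"
    if ind: "\<not> vec.dependent (w ` I)" and u: "\<And>l. l \<in> I \<Longrightarrow> u l \<in> l \<and> u l \<noteq> 0" for u
  proof (rule vec.card_le_dim_spanning[of _ "vec.span (u ` I)"])
    have "finite (w ` I)"
      by (rule vec.finiteI_independent[OF ind])
    then have fin: "finite I"
      using inj by (rule finite_imageD)
    then show "finite (u ` I)"
      by simp
    have "w ` I \<subseteq> vec.span (u ` I)"
    proof clarify
      fix l assume "l \<in> I"
      then have "w l \<in> vec.span {u l}"
        using \<open>I \<subseteq> L\<close> w[of l] u[of l] span_line[of l "u l"] by auto
      then show "w l \<in> vec.span (u ` I)"
        using \<open>l \<in> I\<close> vec.span_mono[of "{u l}" "u ` I"] by auto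
    qed
    then have "card (w ` I) \<le> vec.dim (vec.span (u ` I))"
      using ind by (rule vec.independent_card_le_dim)
    then show "card (u ` I) \<le> vec.dim (vec.span (u ` I))"
      using card_image[OF inj] card_image_le[OF fin, of u] by simp
  qed (simp_all add: vec.span_superset)
  moreover have "I \<in> snd (line_matroid L) \<longleftrightarrow>
      (\<forall>u. (\<forall>l\<in>I. u l \<in> l \<and> u l \<noteq> 0) \<longrightarrow> \<not> vec.dependent (u ` I))"
    using \<open>I \<subseteq> L\<close> by (simp add: line_matroid_def)
  moreover have "\<forall>l\<in>I. w l \<in> l \<and> w l \<noteq> 0"
    using \<open>I \<subseteq> L\<close> w by auto
  ultimately show ?thesis
    by metis
qed

section \<open>The case of a single coordinate\<close>

lemma exists_complete_flag_through:
  fixes u :: "complex ^ 'n"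
  assumes "u \<noteq> 0"
  obtains E where "complete_flag E" "E 1 = vec.span {u}"
proof -
  obtain B where B: "{u} \<subseteq> B" "\<not> vec.dependent B" "UNIV \<subseteq> vec.span B"
    using vec.maximal_independent_subset_extend[of "{u}" UNIV] assms by auto
  then have fin: "finite B"
    by (auto intro: vec.finiteI_independent)
  have card: "card B = CARD('n)"
    using B vec.dim_eq_card_independent[of B] vec.dim_eq_full[of B]
    by (simp add: vec.dimension_def card_cart_basis top.extremum_unique)
  obtain ys where ys: "set ys = B - {u}" "distinct ys"
    using finite_distinct_list[of "B - {u}"] fin by auto
  \<comment> \<open>Listing the basis with \<open>u\<close> first makes the spans of prefixes a flag
    whose first line contains \<open>u\<close>.\<close>
  define xs where "xs = u # ys"
  have xs: "set xs = B" "distinct xs" "length xs = CARD('n)"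
    using ys B card distinct_card[of xs] by (auto simp: xs_def insert_absorb)
  define E where "E k = vec.span (set (take k xs))" for k
  have dim: "vec.dim (E k) = k" if "k \<le> CARD('n)" for k
  proof -
    have "\<not> vec.dependent (set (take k xs))"
      using B xs vec.independent_mono set_take_subset by metis
    then show ?thesis
      using that xs by (simp add: E_def vec.dim_eq_card_independent distinct_card)
  qed
  have "E k \<subset> E (Suc k)" if "k < CARD('n)" for k
  proof
    show "E k \<subseteq> E (Suc k)"
      unfolding E_def by (intro vec.span_mono set_take_subset_set_take) simp
    show "E k \<noteq> E (Suc k)"
      using that dim[of k] dim[of "Suc k"] by auto
  qed
  then have "complete_flag E"
    using dim xs B by (auto simp: complete_flag_def E_def)
  moreover have "E 1 = vec.span {u}"
    by (simp add: E_def xs_def)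
  ultimately show ?thesis
    using that by blast
qed

text \<open>With one index every intersection is a member of the flag, and only \<open>E 1\<close>
  has dimension 1.\<close>

lemma flag_lines_single:
  assumes E: "complete_flag (E :: nat \<Rightarrow> (complex ^ 'n) set)" and single: "\<And>i. i = (j :: 'd::finite)"
  shows "flag_lines (\<lambda>_ :: 'd. E) = {E 1}"
proof -
  have U: "(UNIV :: 'd set) = {j}"
    using single by auto
  have INT: "(\<Inter>i :: 'd. E (a i)) = E (a j)" for a
    unfolding U by simp
  have "vec.dim (E k) = k" if "k \<le> CARD('n)" for k
    using that E by (simp add: complete_flag_def)
  moreover have "1 \<le> CARD('n)"
    by (simp add: Suc_leI)
  ultimately show ?thesis
    unfolding flag_lines_def INT by (auto intro!: exI[of _ "\<lambda>_. 1"])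
qed

lemma T_points_single:
  assumes single: "\<And>i. i = (j :: 'd::finite)"
  shows "(T_points n :: (nat ^ 'd) set) = {\<chi> i. n - 1}"
proof -
  have U: "(UNIV :: 'd set) = {j}"
    using single by auto
  have all_single: "(\<forall>i. P i) \<longleftrightarrow> P j" for P
    using single by metis
  have "weight x = n - 1 \<longleftrightarrow> x = (\<chi> i. n - 1)" for x :: "nat ^ 'd"
    unfolding vec_eq_iff U all_single by simp
  then show ?thesis
    by (auto simp: T_points_def)
qed

section \<open>From the arrangement to labelled vectors\<close>

theorem proposition5p2:
  fixes L :: "(complex ^ 'n) set set"
  assumes "line_arrangement L"
    and "matroid_iso (line_matroid L) (T_matroid CARD('n) :: (nat ^ 'd) matroid)"
  shows "\<exists>E :: 'd \<Rightarrow> nat \<Rightarrow> (complex ^ 'n) set.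
           (\<forall>i. complete_flag (E i)) \<and> L = flag_lines E"
proof -
  let ?T = "T_points CARD('n) :: (nat ^ 'd) set"
  obtain \<phi> where bij: "bij_betw \<phi> L ?T"
    and iso: "\<And>I. I \<subseteq> L \<Longrightarrow> I \<in> snd (line_matroid L) \<longleftrightarrow> \<phi> ` I \<in> snd (T_matroid CARD('n))"
    using assms(2) unfolding matroid_iso_def by (auto simp: line_matroid_def T_matroid_def)
  obtain w where w: "\<And>l. l \<in> L \<Longrightarrow> w l \<in> l \<and> w l \<noteq> 0"
    using line_arrangement_generators assms(1) by blast
  define \<psi> where "\<psi> = inv_into L \<phi>"
  have \<psi>: "bij_betw \<psi> ?T L"
    unfolding \<psi>_def by (rule bij_betw_inv_into[OF bij])
  have \<phi>\<psi>: "\<phi> (\<psi> x) = x" if "x \<in> ?T" for x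
    unfolding \<psi>_def using bij that by (rule bij_betw_inv_into_right)
  define v where "v = w \<circ> \<psi>"
  have v: "vec.span {v x} = \<psi> x" if "x \<in> ?T" for x
    using line_eq_span[of "\<psi> x" "v x"] bij_betwE[OF \<psi>] that w assms(1)
    unfolding line_arrangement_def v_def by auto
  then have L: "L = (\<lambda>x. vec.span {v x}) ` ?T"
    using \<psi> by (simp add: bij_betw_def cong: image_cong)
  show ?thesis
  proof (cases "\<exists>j :: 'd. \<forall>i. i = j")
    case True
    then obtain j :: 'd where single: "\<And>i. i = j"
      by blast
    then obtain x where T: "?T = {x}"
      using T_points_single by blast
    then have "v x \<noteq> 0"
      using w bij_betwE[OF \<psi>] by (auto simp: v_def)
    then obtain E where "complete_flag E" "E 1 = vec.span {v x}"
      using exists_complete_flag_through by blast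
    then have "L = flag_lines (\<lambda>_ :: 'd. E)"
      using flag_lines_single[OF \<open>complete_flag E\<close> single] L unfolding T by simp
    then show ?thesis
      using \<open>complete_flag E\<close> by (intro exI[of _ "\<lambda>_. E"]) auto
  next
    case False
    \<comment> \<open>Independence of labels passes through the isomorphism to their lines and then
      to the chosen generators; \<open>\<psi>\<close> is injective, so no repetitions arise from
      relabelling.\<close>
    interpret T_representation v
    proof
      show "\<exists>i. i \<noteq> j" for j :: 'd
        using False by blast
      fix J assume J: "J \<subseteq> ?T"
      then have sub: "\<psi> ` J \<subseteq> L" and inj: "inj_on \<psi> J"
        using \<psi> inj_on_subset unfolding bij_betw_def by blast+
      have "\<phi> ` \<psi> ` J = J"
        using J \<phi>\<psi> by (force simp: image_image)
      then have "J \<in> snd (T_matroid CARD('n)) \<longleftrightarrow> \<psi> ` J \<in> snd (line_matroid L)"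
        using iso[OF sub] by simp
      also have "\<dots> \<longleftrightarrow> inj_on w (\<psi> ` J) \<and> \<not> vec.dependent (w ` \<psi> ` J)"
        by (rule line_matroid_independent_iff[OF assms(1) sub w])
      also have "\<dots> \<longleftrightarrow> inj_on v J \<and> \<not> vec.dependent (v ` J)"
        using comp_inj_on_iff[OF inj, of w] by (simp add: v_def image_comp)
      finally show "inj_on v J \<and> \<not> vec.dependent (v ` J) \<longleftrightarrow> J \<in> snd (T_matroid CARD('n))"
        by simp
    qed
    show ?thesis
      using complete_flag_simplex_flag flag_lines_simplex_flag L by auto
  qed
qed

end
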